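(* Fix any $\gamma>0$ and consider the non-strongly convex quadratic optimization problem $\min_{x\in\mathbb{R}^d} f(x)$, $f(x)=\frac1n\sum_{i=1}^n f_i(x)$, where $f_i(x)=\frac12 x^\top A_i x-b_i^\top x$ for all $i\in\{1,\dots,n\}$, with $A_i\in\mathbb{R}^{d\times d}$ symmetric positive semidefinite and $b_i\in\mathbb{R}^d$. Assume that there exists $x_*\in\mathbb{R}^d$ such that $\nabla f_i(x_* )=0$ for all $i$ (interpolation). Then FedExProx with nice sampling (minibatch size $S$) and $\alpha=\frac{1}{\gamma L_{\gamma,S}}$ finds $\bar x$ such that $\mathbb{E}[f(\bar x)]-f(x_* )\le\varepsilon$ after $$\mathcal{O}\left(\frac{L_{\gamma,S}}{\mu_\gamma^+}\log\frac1\varepsilon\right)$$ iterations, where $$L_{\gamma,S}:=\frac{n-S}{S(n-1)}\,\frac{L_{\max}}{1+\gamma L_{\max}}+\frac{n(S-1)}{S(n-1)}\,L_\gamma,$$ $L_\gamma$ is the smoothness constant of $M^\gamma$ and $\mu_\gamma^+$ is the smallest non-zero eigenvalue of the matrix $\nabla^2M^\gamma$.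
   Context: For a convex function $g$ and $\gamma>0$, $\mathrm{prox}_{\gamma g}(x)=\arg\min_z\{g(z)+\frac1{2\gamma}\|z-x\|^2\}$ and $M_g^\gamma(x)=\min_z\{g(z)+\frac1{2\gamma}\|z-x\|^2\}$ (Moreau envelope). $M^\gamma=\frac1n\sum_{i=1}^nM^\gamma_{f_i}$; here it is a quadratic with constant Hessian $\nabla^2M^\gamma=\frac1n\sum_{i=1}^n\frac1\gamma\big(I-(\gamma A_i+I)^{-1}\big)$, and $L_\gamma=\lambda_{\max}(\nabla^2M^\gamma)$. $L_{\max}=\max_i\lambda_{\max}(A_i)$ is the largest of the smoothness constants of the $f_i$. FedExProx with nice sampling: given $S\in\{1,\dots,n\}$ and a starting point $x_0\in\mathbb{R}^d$, at each iteration $k$ sample a subset $\mathcal{S}_k\subseteq\{1,\dots,n\}$ uniformly at random from all subsets of cardinality $S$, and set $x_{k+1}=x_k+\alpha\big(\frac1S\sum_{i\in\mathcal{S}_k}\mathrm{prox}_{\gamma f_i}(x_k)-x_k\big)$. *)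

theory Defs
  imports "HOL-Probability.Probability"
begin

definition gradient :: "(real ^ 'd \<Rightarrow> real) \<Rightarrow> real ^ 'd \<Rightarrow> real ^ 'd" where
  "gradient g x = (THE D. GDERIV g x :> D)"

definition hessian :: "(real ^ 'd \<Rightarrow> real) \<Rightarrow> real ^ 'd \<Rightarrow> real ^ 'd ^ 'd" where
  "hessian g x = matrix (frechet_derivative (gradient g) (at x))"

definition sym_psd :: "real ^ 'd ^ 'd \<Rightarrow> bool" where
  "sym_psd A \<longleftrightarrow> transpose A = A \<and> (\<forall>v. 0 \<le> v \<bullet> (A *v v))"

definition eigenvalues :: "real ^ 'd ^ 'd \<Rightarrow> real set" where
  "eigenvalues A = {l. \<exists>v. v \<noteq> 0 \<and> A *v v = l *\<^sub>R v}"

definition lambda_max :: "real ^ 'd ^ 'd \<Rightarrow> real" where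
  "lambda_max A = Max (eigenvalues A)"

text \<open>Smallest non-zero eigenvalue; only meaningful for a matrix that has one.\<close>

definition lambda_min_nz :: "real ^ 'd ^ 'd \<Rightarrow> real" where
  "lambda_min_nz A = Min (eigenvalues A - {0})"

definition prox :: "real \<Rightarrow> (real ^ 'd \<Rightarrow> real) \<Rightarrow> real ^ 'd \<Rightarrow> real ^ 'd" where
  "prox \<gamma> g x = (ARG_MIN (\<lambda>z. g z + 1 / (2 * \<gamma>) * (norm (z - x))\<^sup>2) z. True)"

definition moreau :: "real \<Rightarrow> (real ^ 'd \<Rightarrow> real) \<Rightarrow> real ^ 'd \<Rightarrow> real" where
  "moreau \<gamma> g x = (INF z. g z + 1 / (2 * \<gamma>) * (norm (z - x))\<^sup>2)"

definition quad :: "real ^ 'd ^ 'd \<Rightarrow> real ^ 'd \<Rightarrow> real ^ 'd \<Rightarrow> real" where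
  "quad A b x = 1 / 2 * (x \<bullet> (A *v x)) - b \<bullet> x"

definition avg :: "nat \<Rightarrow> (nat \<Rightarrow> real ^ 'd \<Rightarrow> real) \<Rightarrow> real ^ 'd \<Rightarrow> real" where
  "avg n F x = 1 / real n * (\<Sum>i = 1..n. F i x)"

definition avg_moreau :: "real \<Rightarrow> nat \<Rightarrow> (nat \<Rightarrow> real ^ 'd ^ 'd) \<Rightarrow> (nat \<Rightarrow> real ^ 'd) \<Rightarrow> real ^ 'd \<Rightarrow> real" where
  "avg_moreau \<gamma> n A b = avg n (\<lambda>i. moreau \<gamma> (quad (A i) (b i)))"

text \<open>For positive semidefinite \<open>A i\<close> the averaged envelope is a quadratic, so
  its Hessian does not depend on the point; it is evaluated at the origin.\<close>

definition moreau_hessian :: "real \<Rightarrow> nat \<Rightarrow> (nat \<Rightarrow> real ^ 'd ^ 'd) \<Rightarrow> (nat \<Rightarrow> real ^ 'd) \<Rightarrow> real ^ 'd ^ 'd" where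
  "moreau_hessian \<gamma> n A b = hessian (avg_moreau \<gamma> n A b) 0"

definition L_max :: "nat \<Rightarrow> (nat \<Rightarrow> real ^ 'd ^ 'd) \<Rightarrow> real" where
  "L_max n A = (MAX i \<in> {1..n}. lambda_max (A i))"

definition L_gamma :: "real \<Rightarrow> nat \<Rightarrow> (nat \<Rightarrow> real ^ 'd ^ 'd) \<Rightarrow> (nat \<Rightarrow> real ^ 'd) \<Rightarrow> real" where
  "L_gamma \<gamma> n A b = lambda_max (moreau_hessian \<gamma> n A b)"

definition mu_gamma_plus :: "real \<Rightarrow> nat \<Rightarrow> (nat \<Rightarrow> real ^ 'd ^ 'd) \<Rightarrow> (nat \<Rightarrow> real ^ 'd) \<Rightarrow> real" where
  "mu_gamma_plus \<gamma> n A b = lambda_min_nz (moreau_hessian \<gamma> n A b)"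

definition L_gamma_S :: "real \<Rightarrow> nat \<Rightarrow> nat \<Rightarrow> (nat \<Rightarrow> real ^ 'd ^ 'd) \<Rightarrow> (nat \<Rightarrow> real ^ 'd) \<Rightarrow> real" where
  "L_gamma_S \<gamma> n S A b =
     (real n - real S) / (real S * (real n - 1)) * (L_max n A / (1 + \<gamma> * L_max n A))
     + real n * (real S - 1) / (real S * (real n - 1)) * L_gamma \<gamma> n A b"

definition fedexprox_step ::
    "real \<Rightarrow> real \<Rightarrow> nat \<Rightarrow> (nat \<Rightarrow> real ^ 'd \<Rightarrow> real) \<Rightarrow> nat set \<Rightarrow> real ^ 'd \<Rightarrow> real ^ 'd" where
  "fedexprox_step \<alpha> \<gamma> S F T x = x + \<alpha> *\<^sub>R ((1 / real S) *\<^sub>R (\<Sum>i\<in>T. prox \<gamma> (F i) x) - x)"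

text \<open>The distribution of the \<open>k\<close>-th iterate; the client subset of each iteration is drawn afresh,
  that is, independently of the past.\<close>

primrec fedexprox ::
    "real \<Rightarrow> real \<Rightarrow> nat \<Rightarrow> nat \<Rightarrow> (nat \<Rightarrow> real ^ 'd \<Rightarrow> real) \<Rightarrow> real ^ 'd \<Rightarrow> nat \<Rightarrow> (real ^ 'd) pmf" where
  "fedexprox \<alpha> \<gamma> n S F x\<^sub>0 0 = return_pmf x\<^sub>0"
| "fedexprox \<alpha> \<gamma> n S F x\<^sub>0 (Suc k) =
     bind_pmf (fedexprox \<alpha> \<gamma> n S F x\<^sub>0 k)
       (\<lambda>x. map_pmf (\<lambda>T. fedexprox_step \<alpha> \<gamma> S F T x)
              (pmf_of_set {T. T \<subseteq> {1..n} \<and> card T = S}))"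

end

theory Submission
  imports Defs
begin

text \<open>For quadratics with a common minimizer \<open>y\<close>, the proximal map is
  \<open>x - \<gamma> E\<^sub>i (x - y)\<close> with \<open>E\<^sub>i = A\<^sub>i (I + \<gamma> A\<^sub>i)\<^sup>-\<^sup>1\<close>, so the method is stochastic
  gradient descent with step size \<open>1 / L\<close> on the quadratic form of \<open>H\<close>, the average of the \<open>E\<^sub>i\<close>.
  The second moment of a gradient sampled without replacement splits into the two terms of
  \<open>L\<^sub>\<gamma>\<^sub>,\<^sub>S\<close>, and each is bounded by a multiple of \<open>w \<bullet> H w\<close>, where \<open>w = x - y\<close>. Hence one step decreases
  \<open>\<parallel>w\<parallel>\<^sup>2\<close> in expectation by at least \<open>(w \<bullet> H w) / L\<close>. The kernel of \<open>H\<close> is contained in the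
  kernel of every \<open>A\<^sub>i\<close>; choosing \<open>y\<close> as the minimizer nearest to \<open>x\<^sub>0\<close> keeps all iterates in the
  translate of its orthogonal complement, where \<open>w \<bullet> H w \<ge> \<mu> \<parallel>w\<parallel>\<^sup>2\<close>. This gives the rate
  \<open>1 - \<mu> / L\<close> with leading constant one, so any \<open>C > 1\<close> absorbs the constant factor for small
  \<open>\<epsilon>\<close>.\<close>

section \<open>Symmetric positive semidefinite matrices\<close>

lemma quadratic_nonneg_imp_discriminant:
  fixes a b c :: real
  assumes "\<And>t. 0 \<le> a * t\<^sup>2 + 2 * b * t + c" and "0 \<le> a"
  shows "b\<^sup>2 \<le> a * c"
proof (cases "a = 0")
  case True
  have "b = 0"
  proof (rule ccontr)
    assume "b \<noteq> 0"
    \<comment> \<open>The chosen \<open>t\<close> gives the linear polynomial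
      \<open>2 * b * t + c\<close> the value \<open>-1\<close>.\<close>
    then show False
      using assms(1)[of "- (c + 1) / (2 * b)"] True by (simp add: field_simps)
  qed
  then show ?thesis using True by simp
next
  case False
  with \<open>0 \<le> a\<close> have "0 < a" by simp
  then show ?thesis
    using assms(1)[of "- b / a"] by (simp add: field_simps power2_eq_square)
qed

text \<open>The form is nonnegative along the line \<open>t *\<^sub>R x + y\<close>, so its
  discriminant in \<open>t\<close> is not positive. Nonnegativity is asked for on \<open>V\<close>
  only, because the shifted map in \<open>exists_least_eigenvector\<close> has it only
  there.\<close>

lemma semidefinite_Cauchy_Schwarz:
  fixes g :: "'a::real_inner \<Rightarrow> 'a"
  assumes "linear g" and sym: "\<And>x y. x \<bullet> g y = g x \<bullet> y"
    and "subspace V" and nonneg: "\<And>x. x \<in> V \<Longrightarrow> 0 \<le> x \<bullet> g x"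
    and "x \<in> V" "y \<in> V"
  shows "(x \<bullet> g y)\<^sup>2 \<le> (x \<bullet> g x) * (y \<bullet> g y)"
proof (rule quadratic_nonneg_imp_discriminant)
  fix t :: real
  have yx: "y \<bullet> g x = x \<bullet> g y"
    using sym[of y x] by (simp add: inner_commute)
  have "t *\<^sub>R x + y \<in> V"
    using assms by (simp add: subspace_add subspace_scale)
  from nonneg[OF this]
  show "0 \<le> x \<bullet> g x * t\<^sup>2 + 2 * (x \<bullet> g y) * t + y \<bullet> g y"
    by (simp add: linear_add[OF \<open>linear g\<close>] linear_scale[OF \<open>linear g\<close>] inner_add_left
        inner_add_right yx power2_eq_square algebra_simps)
qed (rule nonneg[OF \<open>x \<in> V\<close>])

text \<open>The form of \<open>g\<close> attains a minimum \<open>m\<close> on the compact unit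
  sphere of \<open>V\<close>. The shift \<open>h = g - m\<close> is then semidefinite on
  \<open>V\<close> and its form vanishes at the minimizer \<open>v\<close>, which forces
  \<open>h v = 0\<close>. The vector \<open>u\<close> makes the sphere nonempty.\<close>

lemma exists_least_eigenvector:
  fixes g :: "'a::euclidean_space \<Rightarrow> 'a"
  assumes "linear g" and sym: "\<And>x y. x \<bullet> g y = g x \<bullet> y"
    and "subspace V" and inv: "\<And>x. x \<in> V \<Longrightarrow> g x \<in> V" and "u \<in> V" "u \<noteq> 0"
  obtains m v where "v \<in> V" "v \<noteq> 0" "g v = m *\<^sub>R v" "\<And>w. w \<in> V \<Longrightarrow> m * (norm w)\<^sup>2 \<le> w \<bullet> g w"
proof -
  let ?K = "sphere 0 1 \<inter> V"
  have "compact ?K"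
    using \<open>subspace V\<close> by (intro compact_Int_closed closed_subspace) auto
  moreover have "(1 / norm u) *\<^sub>R u \<in> ?K"
    using assms by (simp add: subspace_scale)
  then have "?K \<noteq> {}" by blast
  moreover have "continuous_on ?K (\<lambda>w. w \<bullet> g w)"
    using \<open>linear g\<close> by (intro continuous_intros linear_continuous_on)
      (simp add: linear_conv_bounded_linear)
  ultimately obtain v where v: "v \<in> ?K" "\<And>w. w \<in> ?K \<Longrightarrow> v \<bullet> g v \<le> w \<bullet> g w"
    using continuous_attains_inf[of ?K "\<lambda>w. w \<bullet> g w"] by blast
  define m where "m = v \<bullet> g v"
  define h where "h = (\<lambda>x. g x - m *\<^sub>R x)"
  have vV: "v \<in> V" "norm v = 1" using v by auto
  have bound: "m * (norm w)\<^sup>2 \<le> w \<bullet> g w" if "w \<in> V" for w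
  proof (cases "w = 0")
    case False
    have "(1 / norm w) *\<^sub>R w \<in> ?K"
      using that False \<open>subspace V\<close> by (simp add: subspace_scale)
    from v(2)[OF this] show ?thesis
      using False by (simp add: linear_scale[OF \<open>linear g\<close>] m_def field_simps power2_eq_square)
  qed simp
  have hV: "h x \<in> V" if "x \<in> V" for x
    using that inv \<open>subspace V\<close> by (simp add: h_def subspace_diff subspace_scale)
  have "linear h"
    using \<open>linear g\<close> by (simp add: linear_iff h_def algebra_simps)
  moreover have "x \<bullet> h y = h x \<bullet> y" for x y
    using sym[of x y] by (simp add: h_def inner_diff_left inner_diff_right)
  moreover have "0 \<le> x \<bullet> h x" if "x \<in> V" for x
    using bound[OF that] by (simp add: h_def inner_diff_right power2_norm_eq_inner)
  \<comment> \<open>Cauchy-Schwarz for the form of \<open>h\<close>, applied to \<open>h v\<close>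
    and \<open>v\<close>. Invariance of \<open>V\<close> puts \<open>h v\<close> into
    \<open>V\<close>, and the last factor is zero.\<close>
  ultimately have "(h v \<bullet> h v)\<^sup>2 \<le> (h v \<bullet> h (h v)) * (v \<bullet> h v)"
    using semidefinite_Cauchy_Schwarz[of h V "h v" v] \<open>subspace V\<close> vV hV by blast
  moreover have "v \<bullet> h v = 0"
    using vV by (simp add: h_def m_def inner_diff_right flip: power2_norm_eq_inner)
  ultimately have "h v = 0" by simp
  moreover have "v \<noteq> 0" using vV by auto
  ultimately show thesis
    using that[of v m] vV bound by (auto simp: h_def)
qed

lemma symmetric_matrix_inner:
  fixes A :: "real ^ 'd ^ 'd"
  assumes "transpose A = A"
  shows "x \<bullet> (A *v y) = (A *v x) \<bullet> y"
  by (metis assms dot_lmul_matrix transpose_matrix_vector)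

text \<open>Eigenvectors of distinct eigenvalues are orthogonal, hence independent, hence finitely
  many. Finiteness is what gives the \<open>Max\<close> and \<open>Min\<close> in
  \<open>lambda_max\<close> and \<open>lambda_min_nz\<close> their meaning.\<close>

lemma finite_eigenvalues:
  fixes A :: "real ^ 'd ^ 'd"
  assumes "transpose A = A"
  shows "finite (eigenvalues A)"
proof -
  have "\<forall>l\<in>eigenvalues A. \<exists>v. v \<noteq> 0 \<and> A *v v = l *\<^sub>R v"
    by (auto simp: eigenvalues_def)
  then obtain v where v: "\<And>l. l \<in> eigenvalues A \<Longrightarrow> v l \<noteq> 0 \<and> A *v v l = l *\<^sub>R v l"
    by metis
  have orth: "v l \<bullet> v l' = 0" if "l \<in> eigenvalues A" "l' \<in> eigenvalues A" "l \<noteq> l'" for l l'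
    using symmetric_matrix_inner[OF assms, of "v l" "v l'"] v that by simp
  have "inj_on v (eigenvalues A)"
  proof (rule inj_onI, rule ccontr)
    fix l l' assume "l \<in> eigenvalues A" "l' \<in> eigenvalues A" "v l = v l'" "l \<noteq> l'"
    then show False using orth[of l l'] v[of l'] by simp
  qed
  moreover have "pairwise orthogonal (v ` eigenvalues A)"
    using orth by (force simp: pairwise_def orthogonal_def)
  then have "independent (v ` eigenvalues A)"
    using v by (intro pairwise_orthogonal_independent) force+
  then have "finite (v ` eigenvalues A)"
    by (rule finiteI_independent)
  ultimately show ?thesis
    using finite_imageD by blast
qed

context
  fixes A :: "real ^ 'd ^ 'd"
  assumes psd: "sym_psd A"
begin

lemma sym_psd_inner_commute: "x \<bullet> (A *v y) = (A *v x) \<bullet> y"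
  using psd symmetric_matrix_inner by (auto simp: sym_psd_def)

lemma sym_psd_nonneg: "0 \<le> x \<bullet> (A *v x)"
  using psd by (auto simp: sym_psd_def)

lemma sym_psd_finite_eigenvalues: "finite (eigenvalues A)"
  using psd finite_eigenvalues by (auto simp: sym_psd_def)

text \<open>The least eigenvalue \<open>m\<close> of \<open>- A\<close> on the whole space bounds
  its form from below, and \<open>- m\<close> is an eigenvalue of \<open>A\<close>.\<close>

lemma sym_psd_inner_le: "w \<bullet> (A *v w) \<le> lambda_max A * (norm w)\<^sup>2"
proof -
  obtain e :: "real ^ 'd" where "e \<noteq> 0"
    using vector_choose_size[of 1] by force
  have sym: "x \<bullet> - (A *v y) = - (A *v x) \<bullet> y" for x y
    using sym_psd_inner_commute[of x y] by simp
  have lin: "linear (\<lambda>x. - (A *v x))"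
    by (intro linear_compose_neg matrix_vector_mul_linear)
  obtain m v where v: "v \<noteq> 0" "- (A *v v) = m *\<^sub>R v"
    and le: "\<And>w. m * (norm w)\<^sup>2 \<le> w \<bullet> - (A *v w)"
    by (rule exists_least_eigenvector[OF lin sym subspace_UNIV UNIV_I UNIV_I \<open>e \<noteq> 0\<close>])
       (rule that; blast)
  have "A *v v = (- m) *\<^sub>R v" using v(2) by (metis minus_minus scaleR_minus_left)
  then have "- m \<in> eigenvalues A"
    using v(1) by (auto simp: eigenvalues_def)
  then have "- m \<le> lambda_max A"
    using sym_psd_finite_eigenvalues by (simp add: lambda_max_def)
  then have "- m * (norm w)\<^sup>2 \<le> lambda_max A * (norm w)\<^sup>2"
    by (rule mult_right_mono) simp
  then show ?thesis using le[of w] by simp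
qed

text \<open>Cauchy-Schwarz for the form of \<open>A\<close> at \<open>A *v w\<close> and
  \<open>w\<close>, followed by cancelling one factor of the squared norm of \<open>A *v w\<close>.
  This is cocoercivity of the gradient of the quadratic.\<close>

lemma sym_psd_norm_le: "(norm (A *v w))\<^sup>2 \<le> lambda_max A * (w \<bullet> (A *v w))"
proof (cases "A *v w = 0")
  case False
  let ?a = "A *v w"
  have "(?a \<bullet> ?a)\<^sup>2 \<le> (?a \<bullet> (A *v ?a)) * (w \<bullet> ?a)"
    using semidefinite_Cauchy_Schwarz[of "(*v) A" UNIV ?a w] sym_psd_inner_commute sym_psd_nonneg
    by auto
  also have "\<dots> \<le> (lambda_max A * (norm ?a)\<^sup>2) * (w \<bullet> ?a)"
    by (intro mult_right_mono sym_psd_inner_le sym_psd_nonneg)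
  finally have "(norm ?a)\<^sup>2 * (norm ?a)\<^sup>2 \<le> (norm ?a)\<^sup>2 * (lambda_max A * (w \<bullet> ?a))"
    by (simp add: dot_square_norm power2_eq_square mult_ac)
  then show ?thesis
    by (rule mult_left_le_imp_le) (use False in simp)
qed simp

lemma sym_psd_lambda_max_nonneg: "0 \<le> lambda_max A"
proof -
  obtain e :: "real ^ 'd" where "norm e = 1"
    using vector_choose_size[of 1] by auto
  then show ?thesis
    using sym_psd_inner_le[of e] sym_psd_nonneg[of e] by simp
qed

lemma sym_psd_lambda_max_pos:
  assumes "A \<noteq> 0"
  shows "0 < lambda_max A"
proof -
  obtain w where "A *v w \<noteq> 0"
    using assms by (metis matrix_eq matrix_vector_mult_0)
  then have "0 < (norm (A *v w))\<^sup>2" by simp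
  also have "\<dots> \<le> lambda_max A * (w \<bullet> (A *v w))" by (rule sym_psd_norm_le)
  finally show ?thesis
    using sym_psd_nonneg[of w] by (simp add: zero_less_mult_iff)
qed

text \<open>The orthogonal complement of the kernel contains the range, so it is invariant and has a
  least eigenvector. Its eigenvalue \<open>m\<close> is nonzero, since a kernel vector in the
  complement is orthogonal to itself; so \<open>m\<close> competes in the
  \<open>Min\<close>.\<close>

lemma sym_psd_lambda_min_nz:
  assumes "A \<noteq> 0"
  shows "0 < lambda_min_nz A"
    and "(\<And>q. A *v q = 0 \<Longrightarrow> q \<bullet> w = 0) \<Longrightarrow> lambda_min_nz A * (norm w)\<^sup>2 \<le> w \<bullet> (A *v w)"
proof -
  let ?V = "{w. \<forall>q. A *v q = 0 \<longrightarrow> q \<bullet> w = 0}"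
  obtain u where u: "A *v u \<noteq> 0"
    using assms by (metis matrix_eq matrix_vector_mult_0)
  have range: "A *v x \<in> ?V" for x
    using sym_psd_inner_commute by simp
  have sub: "subspace ?V"
    by (auto simp: subspace_def inner_add_right)
  obtain m v where v: "v \<in> ?V" "v \<noteq> 0" "A *v v = m *\<^sub>R v"
    and le: "\<And>w. w \<in> ?V \<Longrightarrow> m * (norm w)\<^sup>2 \<le> w \<bullet> (A *v w)"
    by (rule exists_least_eigenvector[OF matrix_vector_mul_linear sym_psd_inner_commute sub range range u])
       (rule that; blast)
  have "m \<noteq> 0"
  proof
    assume "m = 0"
    then have "v \<bullet> v = 0" using v by simp
    then show False using v by simp
  qed
  then have m: "m \<in> eigenvalues A - {0}"
    using v by (auto simp: eigenvalues_def)
  have fin: "finite (eigenvalues A - {0})"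
    using sym_psd_finite_eigenvalues by simp
  have "lambda_min_nz A \<in> eigenvalues A - {0}"
    unfolding lambda_min_nz_def using fin m by (intro Min_in) auto
  then obtain e where e: "e \<noteq> 0" "A *v e = lambda_min_nz A *\<^sub>R e" "lambda_min_nz A \<noteq> 0"
    by (auto simp: eigenvalues_def)
  then have "0 \<le> lambda_min_nz A * (e \<bullet> e)"
    using sym_psd_nonneg[of e] by simp
  then have "0 \<le> lambda_min_nz A"
    using e(1) inner_gt_zero_iff[of e] by (auto simp: zero_le_mult_iff simp del: inner_gt_zero_iff)
  then show "0 < lambda_min_nz A" using e(3) by simp
  assume "\<And>q. A *v q = 0 \<Longrightarrow> q \<bullet> w = 0"
  then have "m * (norm w)\<^sup>2 \<le> w \<bullet> (A *v w)" by (intro le) auto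
  moreover have "lambda_min_nz A \<le> m"
    unfolding lambda_min_nz_def using fin m by (rule Min_le)
  then have "lambda_min_nz A * (norm w)\<^sup>2 \<le> m * (norm w)\<^sup>2"
    by (rule mult_right_mono) simp
  ultimately show "lambda_min_nz A * (norm w)\<^sup>2 \<le> w \<bullet> (A *v w)" by simp
qed

end

section \<open>Moreau envelopes of quadratics\<close>

definition resolvent :: "real \<Rightarrow> real ^ 'd ^ 'd \<Rightarrow> real ^ 'd ^ 'd" where
  "resolvent \<gamma> A = matrix_inv (mat 1 + \<gamma> *\<^sub>R A)"

text \<open>Equal to \<open>(I - resolvent \<gamma> A) / \<gamma>\<close>; the product form keeps \<open>A\<close> visible.\<close>

definition env_hessian :: "real \<Rightarrow> real ^ 'd ^ 'd \<Rightarrow> real ^ 'd ^ 'd" where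
  "env_hessian \<gamma> A = A ** resolvent \<gamma> A"

context
  fixes A :: "real ^ 'd ^ 'd" and \<gamma> :: real
  assumes psd: "sym_psd A" and \<gamma>: "0 < \<gamma>"
begin

text \<open>The form of \<open>I + \<gamma> A\<close> dominates the squared norm, so this matrix is
  injective and \<open>matrix_inv\<close> chooses a true inverse. All later facts about
  \<open>resolvent\<close> rest on this equation.\<close>

lemma resolvent_eq: "resolvent \<gamma> A *v w + \<gamma> *\<^sub>R (A *v (resolvent \<gamma> A *v w)) = w"
proof -
  let ?M = "mat 1 + \<gamma> *\<^sub>R A"
  have M: "?M *v x = x + \<gamma> *\<^sub>R (A *v x)" for x
    by (simp add: matrix_vector_mult_add_rdistrib scaleR_matrix_vector_assoc)
  have "x = 0" if "?M *v x = 0" for x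
  proof -
    have "x \<bullet> x + \<gamma> * (x \<bullet> (A *v x)) = 0"
      using that unfolding M by (metis inner_add_right inner_scaleR_right inner_zero_right)
    then have "x \<bullet> x \<le> 0"
      using sym_psd_nonneg[OF psd, of x] \<gamma> by (smt (verit) mult_nonneg_nonneg)
    then show ?thesis by (metis inner_gt_zero_iff not_le)
  qed
  then have "invertible ?M"
    by (auto simp: invertible_left_inverse matrix_left_invertible_ker)
  then have "?M ** resolvent \<gamma> A = mat 1"
    unfolding resolvent_def matrix_inv_def invertible_def by (rule someI2_ex) simp
  then have "?M *v (resolvent \<gamma> A *v w) = w"
    by (simp add: matrix_vector_mul_assoc)
  then show ?thesis unfolding M .
qed

lemma env_hessian_vector: "env_hessian \<gamma> A *v w = A *v (resolvent \<gamma> A *v w)"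
  by (simp add: env_hessian_def matrix_vector_mul_assoc)

lemma resolvent_vector: "resolvent \<gamma> A *v w = w - \<gamma> *\<^sub>R (env_hessian \<gamma> A *v w)"
  using resolvent_eq[of w] by (simp add: env_hessian_vector algebra_simps)

text \<open>Expanding \<open>x\<close> by \<open>resolvent_eq\<close> leaves an expression symmetric
  in the two resolvents, so commutation of \<open>A\<close> with its resolvent need not be
  proved.\<close>

lemma env_hessian_inner_commute: "x \<bullet> (env_hessian \<gamma> A *v y) = (env_hessian \<gamma> A *v x) \<bullet> y"
proof -
  let ?R = "\<lambda>x. resolvent \<gamma> A *v x"
  have "x \<bullet> (env_hessian \<gamma> A *v y) = (?R x + \<gamma> *\<^sub>R (A *v ?R x)) \<bullet> (A *v ?R y)"
    by (simp add: env_hessian_vector resolvent_eq)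
  also have "\<dots> = (A *v ?R x) \<bullet> (?R y + \<gamma> *\<^sub>R (A *v ?R y))"
    using sym_psd_inner_commute[OF psd, of "?R x" "?R y"]
    by (simp add: inner_add_left inner_add_right)
  finally show ?thesis
    by (simp add: env_hessian_vector resolvent_eq)
qed

lemma env_hessian_inner:
  "w \<bullet> (env_hessian \<gamma> A *v w) =
     (resolvent \<gamma> A *v w) \<bullet> (A *v (resolvent \<gamma> A *v w)) + \<gamma> * (norm (env_hessian \<gamma> A *v w))\<^sup>2"
proof -
  let ?u = "resolvent \<gamma> A *v w"
  have "w \<bullet> (env_hessian \<gamma> A *v w) = (?u + \<gamma> *\<^sub>R (A *v ?u)) \<bullet> (A *v ?u)"
    by (simp add: env_hessian_vector resolvent_eq)
  then show ?thesis
    by (simp add: inner_add_left env_hessian_vector power2_norm_eq_inner)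
qed

lemma env_hessian_nonneg: "0 \<le> w \<bullet> (env_hessian \<gamma> A *v w)"
  using \<gamma> sym_psd_nonneg[OF psd] by (simp add: env_hessian_inner)

text \<open>With \<open>u\<close> the resolvent of \<open>w\<close>, the squared norm of
  \<open>A *v u\<close> is at most \<open>l\<close> times the form of \<open>A\<close> at
  \<open>u\<close>, and by \<open>env_hessian_inner\<close> that form is the one of the envelope
  Hessian minus \<open>\<gamma>\<close> times the same squared norm. Solving for the squared norm
  gives the denominator \<open>1 + \<gamma> * l\<close>.\<close>

lemma env_hessian_norm_le:
  assumes "lambda_max A \<le> l"
  shows "(norm (env_hessian \<gamma> A *v w))\<^sup>2 \<le> l / (1 + \<gamma> * l) * (w \<bullet> (env_hessian \<gamma> A *v w))"
proof -
  let ?u = "resolvent \<gamma> A *v w" and ?h = "(norm (env_hessian \<gamma> A *v w))\<^sup>2"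
  have l: "0 \<le> l" "0 < 1 + \<gamma> * l"
    using assms sym_psd_lambda_max_nonneg[OF psd] \<gamma> by (auto intro: add_pos_nonneg)
  have "?h \<le> lambda_max A * (?u \<bullet> (A *v ?u))"
    unfolding env_hessian_vector by (rule sym_psd_norm_le[OF psd])
  also have "\<dots> \<le> l * (?u \<bullet> (A *v ?u))"
    using assms by (intro mult_right_mono sym_psd_nonneg[OF psd])
  finally have "?h * (1 + \<gamma> * l) \<le> l * (w \<bullet> (env_hessian \<gamma> A *v w))"
    by (simp add: env_hessian_inner algebra_simps)
  then show ?thesis
    using l by (simp add: pos_le_divide_eq)
qed

lemma env_hessian_kernel:
  assumes "env_hessian \<gamma> A *v w = 0"
  shows "A *v w = 0"
proof -
  have "resolvent \<gamma> A *v w = w"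
    unfolding resolvent_vector assms by simp
  then show ?thesis
    using assms unfolding env_hessian_vector by simp
qed

text \<open>Completing the square at the minimizer of the proximal objective.\<close>

lemma proximal_objective_eq:
  assumes b: "A *v y = b"
  shows "quad A b z + 1 / (2 * \<gamma>) * (norm (z - x))\<^sup>2 =
    (quad A b y + 1 / 2 * ((x - y) \<bullet> (env_hessian \<gamma> A *v (x - y))))
    + (1 / 2 * ((z - (y + resolvent \<gamma> A *v (x - y))) \<bullet> (A *v (z - (y + resolvent \<gamma> A *v (x - y)))))
       + 1 / (2 * \<gamma>) * (norm (z - (y + resolvent \<gamma> A *v (x - y))))\<^sup>2)"
proof -
  define w where "w = x - y"
  define u where "u = resolvent \<gamma> A *v w"
  define d where "d = z - (y + u)"
  have w: "w = u + \<gamma> *\<^sub>R (A *v u)" by (simp add: u_def resolvent_eq)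
  have z: "z = y + u + d" and zx: "z - x = d - \<gamma> *\<^sub>R (A *v u)"
    using w by (auto simp: d_def w_def algebra_simps)
  have comm: "y \<bullet> (A *v u) = u \<bullet> (A *v y)" "y \<bullet> (A *v d) = d \<bullet> (A *v y)" "u \<bullet> (A *v d) = d \<bullet> (A *v u)"
    using sym_psd_inner_commute[OF psd] by (metis inner_commute)+
  have "quad A b z = quad A b y + 1/2 * (u \<bullet> (A *v u)) + d \<bullet> (A *v u) + 1/2 * (d \<bullet> (A *v d))"
    unfolding z quad_def b[symmetric]
    by (simp add: matrix_vector_right_distrib inner_add_left inner_add_right comm inner_commute[of "A *v y"]
        algebra_simps)
  moreover have "1 / (2 * \<gamma>) * (norm (z - x))\<^sup>2 =
      1 / (2 * \<gamma>) * (norm d)\<^sup>2 - d \<bullet> (A *v u) + \<gamma> / 2 * ((A *v u) \<bullet> (A *v u))"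
    using \<gamma> unfolding zx power2_norm_eq_inner
    by (simp add: inner_diff_left inner_diff_right inner_commute[of "A *v u" d] field_simps power2_eq_square)
  moreover have "w \<bullet> (env_hessian \<gamma> A *v w) = u \<bullet> (A *v u) + \<gamma> * ((A *v u) \<bullet> (A *v u))"
    using env_hessian_inner[of w] by (simp add: env_hessian_vector u_def power2_norm_eq_inner)
  ultimately show ?thesis
    unfolding w_def[symmetric] u_def[symmetric] d_def[symmetric] by (simp add: algebra_simps)
qed

lemma proximal_gap_pos:
  assumes "d \<noteq> 0"
  shows "0 < 1 / 2 * (d \<bullet> (A *v d)) + 1 / (2 * \<gamma>) * (norm d)\<^sup>2"
  using assms \<gamma> sym_psd_nonneg[OF psd, of d] by (intro add_nonneg_pos) auto

lemma prox_quad: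
  assumes b: "A *v y = b"
  shows "prox \<gamma> (quad A b) x = y + resolvent \<gamma> A *v (x - y)" (is "_ = ?p")
proof -
  let ?\<phi> = "\<lambda>z. quad A b z + 1 / (2 * \<gamma>) * (norm (z - x))\<^sup>2"
  have less: "?\<phi> ?p < ?\<phi> z" if "z \<noteq> ?p" for z
    using proximal_gap_pos[of "z - ?p"] that
    unfolding proximal_objective_eq[OF b, of z x] proximal_objective_eq[OF b, of ?p x] by simp
  \<comment> \<open>\<open>ARG_MIN\<close> only picks some minimizer; the strict inequality
    \<open>less\<close> makes it unique.\<close>
  have "is_arg_min ?\<phi> (\<lambda>_. True) (prox \<gamma> (quad A b) x)"
    unfolding prox_def
  proof (rule arg_minI[where x = ?p])
    show "\<not> ?\<phi> z < ?\<phi> ?p" for z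
      using less[of z] by (cases "z = ?p") (auto simp: not_less)
  qed (auto simp: is_arg_min_def)
  then show ?thesis
    using less unfolding is_arg_min_def by blast
qed

lemma moreau_quad:
  assumes b: "A *v y = b"
  shows "moreau \<gamma> (quad A b) x = quad A b y + 1 / 2 * ((x - y) \<bullet> (env_hessian \<gamma> A *v (x - y)))"
    (is "_ = ?m")
  unfolding moreau_def
proof (rule cInf_eq_minimum)
  let ?\<phi> = "\<lambda>z. quad A b z + 1 / (2 * \<gamma>) * (norm (z - x))\<^sup>2"
  let ?p = "y + resolvent \<gamma> A *v (x - y)"
  have "?\<phi> ?p = ?m"
    unfolding proximal_objective_eq[OF b, of ?p x] by simp
  then show "?m \<in> range ?\<phi>"
    by (intro range_eqI[of _ _ ?p]) (rule sym)
  fix r assume "r \<in> range ?\<phi>"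
  then obtain z where "r = ?\<phi> z" by blast
  then have "r - ?m = 1 / 2 * ((z - ?p) \<bullet> (A *v (z - ?p))) + 1 / (2 * \<gamma>) * (norm (z - ?p))\<^sup>2"
    using proximal_objective_eq[OF b, of z x] by linarith
  then show "?m \<le> r"
    using \<gamma> sym_psd_nonneg[OF psd, of "z - ?p"] by (smt (verit) divide_nonneg_nonneg mult_nonneg_nonneg zero_le_power2)
qed

end

section \<open>Sampling without replacement\<close>

text \<open>Removing \<open>B\<close> is a bijection onto the subsets of \<open>N - B\<close> with
  \<open>k - card B\<close> elements. For larger \<open>B\<close> the truncated subtraction would
  wrongly count one subset.\<close>

lemma card_subsets_containing:
  assumes "finite N" "B \<subseteq> N" "card B \<le> k"
  shows "card {T. T \<subseteq> N \<and> card T = k \<and> B \<subseteq> T} = (card N - card B) choose (k - card B)"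
proof -
  have fin: "finite B" using assms finite_subset by blast
  have "bij_betw (\<lambda>U. U \<union> B) {U. U \<subseteq> N - B \<and> card U = k - card B}
          {T. T \<subseteq> N \<and> card T = k \<and> B \<subseteq> T}"
  proof (rule bij_betw_byWitness[where f' = "\<lambda>T. T - B"])
    show "(\<lambda>U. U \<union> B) ` {U. U \<subseteq> N - B \<and> card U = k - card B}
            \<subseteq> {T. T \<subseteq> N \<and> card T = k \<and> B \<subseteq> T}"
    proof safe
      fix U assume U: "U \<subseteq> N - B" "card U = k - card B"
      then have "finite U" using assms(1) finite_subset by blast
      then show "card (U \<union> B) = k"
        using U assms(3) fin by (subst card_Un_disjoint) auto
    qed (use assms in auto)
    show "(\<lambda>T. T - B) ` {T. T \<subseteq> N \<and> card T = k \<and> B \<subseteq> T}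
            \<subseteq> {U. U \<subseteq> N - B \<and> card U = k - card B}"
      using fin by (auto simp: card_Diff_subset)
  qed auto
  then have "card {T. T \<subseteq> N \<and> card T = k \<and> B \<subseteq> T} = card {U. U \<subseteq> N - B \<and> card U = k - card B}"
    by (rule bij_betw_same_card[symmetric])
  also have "\<dots> = card (N - B) choose (k - card B)"
    using assms(1) by (intro n_subsets) simp
  finally show ?thesis
    using assms(2) fin by (simp add: card_Diff_subset)
qed

lemma card_subsets_containing_element:
  assumes "finite N" "card N = n" "i \<in> N" "1 \<le> k"
  shows "real (card {T. T \<subseteq> N \<and> card T = k \<and> i \<in> T}) = (n choose k) * (k / n)"
proof -
  have "0 < n" using assms(1-3) card_gt_0_iff by blast
  have "k * (n choose k) = n * ((n - 1) choose (k - 1))"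
    using times_binomial_minus1_eq[of k n] assms by simp
  then have "real k * (n choose k) = n * ((n - 1) choose (k - 1))"
    by (metis of_nat_mult)
  then show ?thesis
    using card_subsets_containing[of N "{i}" k] assms \<open>0 < n\<close> by (simp add: field_simps)
qed

text \<open>Double counting: every element lies in the same number of subsets. Divided by the number
  of subsets, this is unbiasedness of the sample mean.\<close>

lemma sum_subset_sums:
  fixes h :: "'b \<Rightarrow> 'a::real_vector"
  assumes "finite N" "card N = n" "1 \<le> k"
  shows "(\<Sum>T | T \<subseteq> N \<and> card T = k. \<Sum>i\<in>T. h i) = ((n choose k) * (k / n)) *\<^sub>R (\<Sum>i\<in>N. h i)"
proof -
  let ?\<T> = "{T. T \<subseteq> N \<and> card T = k}"
  have fin: "finite ?\<T>" using assms(1) by simp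
  have "(\<Sum>T\<in>?\<T>. \<Sum>i\<in>T. h i) = (\<Sum>T\<in>?\<T>. \<Sum>i\<in>{i \<in> N. i \<in> T}. h i)"
    by (intro sum.cong) auto
  also have "\<dots> = (\<Sum>i\<in>N. \<Sum>T\<in>{T \<in> ?\<T>. i \<in> T}. h i)"
    using sum.swap_restrict[OF fin assms(1), of "\<lambda>T i. h i" "\<lambda>T i. i \<in> T"] .
  also have "\<dots> = (\<Sum>i\<in>N. real (card {T. T \<subseteq> N \<and> card T = k \<and> i \<in> T}) *\<^sub>R h i)"
    by (simp add: sum_constant_scaleR conj_assoc)
  also have "\<dots> = (\<Sum>i\<in>N. ((n choose k) * (k / n)) *\<^sub>R h i)"
    using card_subsets_containing_element[OF assms(1,2) _ assms(3)] by simp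
  finally show ?thesis by (simp add: scaleR_sum_right)
qed

text \<open>The squares expand into inner products of pairs, and \<open>c i j\<close> counts the
  subsets that contain both members. It equals \<open>p\<close> on the diagonal and \<open>q\<close>
  off it, so the sum is \<open>q\<close> times the full double sum plus \<open>p - q\<close> times
  its diagonal.\<close>

lemma sum_norm_subset_sums:
  fixes h :: "'b \<Rightarrow> 'a::real_inner"
  assumes "finite N" "card N = n" "2 \<le> n" "1 \<le> k"
  shows "(\<Sum>T | T \<subseteq> N \<and> card T = k. (norm (\<Sum>i\<in>T. h i))\<^sup>2) =
    (n choose k) * (k / n * (\<Sum>i\<in>N. (norm (h i))\<^sup>2)
      + k * (real k - 1) / (n * (real n - 1))
        * ((norm (\<Sum>i\<in>N. h i))\<^sup>2 - (\<Sum>i\<in>N. (norm (h i))\<^sup>2)))"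
proof -
  let ?\<T> = "{T. T \<subseteq> N \<and> card T = k}"
  define c where "c i j = (\<Sum>T\<in>?\<T>. if i \<in> T \<and> j \<in> T then 1 else 0 :: real)" for i j
  define p where "p = (n choose k) * (real k / n)"
  define q where "q = (n choose k) * (real k * (real k - 1) / (n * (real n - 1)))"
  have fin: "finite ?\<T>" using assms(1) by simp
  have c_card: "c i j = card {T. T \<subseteq> N \<and> card T = k \<and> {i, j} \<subseteq> T}" for i j
    using fin unfolding c_def by (simp add: sum.If_cases Collect_conj_eq[symmetric] conj_assoc)
  have absorb: "real n * ((n - 1) choose (k - 1)) = k * (n choose k)"
    using times_binomial_minus1_eq[of k n] assms by (metis less_le_trans zero_less_one of_nat_mult)
  have p: "c i i = p" if "i \<in> N" for i
    using card_subsets_containing_element[OF assms(1,2) that assms(4)]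
    unfolding c_card p_def by simp
  have q: "c i j = q" if "i \<in> N" "j \<in> N" "i \<noteq> j" for i j
  \<comment> \<open>For \<open>k = 1\<close> the natural number \<open>k - 2\<close> is truncated to
    zero, so the binomial formula fails; the count is zero, as is the factor
    \<open>real k - 1\<close> in \<open>q\<close>.\<close>
  proof (cases "k = 1")
    case True
    have "{T. T \<subseteq> N \<and> card T = k \<and> {i, j} \<subseteq> T} = {}"
      using that True by (auto simp: card_1_singleton_iff)
    then show ?thesis unfolding c_card q_def using True by (metis card.empty diff_self mult_zero_left mult_zero_right of_nat_0 of_nat_1 divide_eq_0_iff)
  next
    case False
    then have "2 \<le> k" using assms by simp
    then have "(k - 1) * ((n - 1) choose (k - 1)) = (n - 1) * ((n - 2) choose (k - 2))"
      using times_binomial_minus1_eq[of "k - 1" "n - 1"] by (simp add: numeral_2_eq_2)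
    then have "real (k - 1) * ((n - 1) choose (k - 1)) = real (n - 1) * ((n - 2) choose (k - 2))"
      by (metis of_nat_mult)
    then have absorb': "(real k - 1) * ((n - 1) choose (k - 1)) = (real n - 1) * ((n - 2) choose (k - 2))"
      using assms by (simp add: of_nat_diff)
    have "real n * (real n - 1) * ((n - 2) choose (k - 2)) = (real k - 1) * (real n * ((n - 1) choose (k - 1)))"
      using absorb' by (simp add: mult_ac)
    also have "\<dots> = (real k - 1) * (k * (n choose k))"
      unfolding absorb ..
    finally have "real n * (real n - 1) * c i j = (real k - 1) * (k * (n choose k))"
      using card_subsets_containing[of N "{i, j}" k] that assms \<open>2 \<le> k\<close> unfolding c_card by (simp add: numeral_2_eq_2)
    moreover have "real n \<noteq> 0" "real n - 1 \<noteq> 0" using assms(3) by auto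
    ultimately show ?thesis
      unfolding q_def by (simp add: nonzero_eq_divide_eq mult_ac)
  qed
  have "(\<Sum>T\<in>?\<T>. (norm (\<Sum>i\<in>T. h i))\<^sup>2) =
        (\<Sum>T\<in>?\<T>. \<Sum>i\<in>N. \<Sum>j\<in>N. (if i \<in> T \<and> j \<in> T then 1 else 0) * (h i \<bullet> h j))"
  proof (rule sum.cong[OF refl])
    fix T assume T: "T \<in> ?\<T>"
    have "(\<Sum>i\<in>T. h i) = (\<Sum>i\<in>N. (if i \<in> T then 1 else 0) *\<^sub>R h i)"
      using T assms(1) by (simp add: if_distrib[of "\<lambda>c. c *\<^sub>R _"] sum.If_cases Int_absorb1 cong: if_cong)
    then show "(norm (\<Sum>i\<in>T. h i))\<^sup>2 = (\<Sum>i\<in>N. \<Sum>j\<in>N. (if i \<in> T \<and> j \<in> T then 1 else 0) * (h i \<bullet> h j))"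
      by (auto simp: power2_norm_eq_inner inner_sum_left inner_sum_right inner_commute intro!: sum.cong)
  qed
  also have "\<dots> = (\<Sum>i\<in>N. \<Sum>j\<in>N. c i j * (h i \<bullet> h j))"
    unfolding c_def sum_distrib_right
    by (subst sum.swap, rule sum.cong[OF refl], subst sum.swap, rule refl)
  also have "\<dots> = (\<Sum>i\<in>N. \<Sum>j\<in>N. q * (h i \<bullet> h j) + (if j = i then (p - q) * (h i \<bullet> h i) else 0))"
    using p q by (intro sum.cong) (auto simp: algebra_simps)
  also have "\<dots> = q * (norm (\<Sum>i\<in>N. h i))\<^sup>2 + (p - q) * (\<Sum>i\<in>N. (norm (h i))\<^sup>2)"
    using assms(1)
    by (simp add: sum.distrib power2_norm_eq_inner inner_sum_left inner_sum_right sum_distrib_left)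
       (rule sum.swap)
  finally show ?thesis
    unfolding p_def q_def by (simp add: algebra_simps)
qed

section \<open>Gradients and Hessians of quadratics\<close>

lemma gradient_eqI:
  assumes "GDERIV g x :> D"
  shows "gradient g x = D"
  unfolding gradient_def
proof (rule the_equality)
  fix E assume "GDERIV g x :> E"
  then have "(\<lambda>h. h \<bullet> E) = (\<lambda>h. h \<bullet> D)"
    using assms has_derivative_unique unfolding gderiv_def by blast
  then show "E = D"
    by (metis inner_commute vector_eq_ldot)
qed (rule assms)

lemma has_derivative_matrix_vector:
  fixes H :: "real ^ 'd ^ 'd"
  shows "((\<lambda>x. H *v (x - y)) has_derivative (\<lambda>h. H *v h)) (at x)"
proof -
  have "((\<lambda>x. x - y) has_derivative (\<lambda>h. h)) (at x)"
    using has_derivative_diff[OF has_derivative_ident has_derivative_const] by simp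
  then show ?thesis
    by (rule bounded_linear.has_derivative[OF matrix_vector_mul_bounded_linear])
qed

lemma GDERIV_quadratic:
  fixes H :: "real ^ 'd ^ 'd"
  assumes sym: "\<And>x y. x \<bullet> (H *v y) = (H *v x) \<bullet> y"
  shows "GDERIV (\<lambda>x. c + 1 / 2 * ((x - y) \<bullet> (H *v (x - y)))) x :> H *v (x - y)"
proof -
  have "((\<lambda>x. x - y) has_derivative (\<lambda>h. h)) (at x)"
    using has_derivative_diff[OF has_derivative_ident has_derivative_const] by simp
  then have "((\<lambda>x. (x - y) \<bullet> (H *v (x - y))) has_derivative
      (\<lambda>h. (x - y) \<bullet> (H *v h) + h \<bullet> (H *v (x - y)))) (at x)"
    by (rule has_derivative_inner[OF _ has_derivative_matrix_vector])
  moreover have "(\<lambda>h. (x - y) \<bullet> (H *v h) + h \<bullet> (H *v (x - y))) = (\<lambda>h. 2 * (h \<bullet> (H *v (x - y))))"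
    using sym[of "x - y"] by (simp only: inner_commute[of "H *v (x - y)"]) simp
  ultimately have "((\<lambda>x. (x - y) \<bullet> (H *v (x - y))) has_derivative
      (\<lambda>h. 2 * (h \<bullet> (H *v (x - y))))) (at x)"
    by simp
  from has_derivative_add[OF has_derivative_const has_derivative_mult_right[OF this, of "1 / 2"]]
  show ?thesis
    unfolding gderiv_def by simp
qed

lemma hessian_quadratic:
  fixes H :: "real ^ 'd ^ 'd"
  assumes "\<And>x y. x \<bullet> (H *v y) = (H *v x) \<bullet> y"
  shows "hessian (\<lambda>x. c + 1 / 2 * ((x - y) \<bullet> (H *v (x - y)))) x = H"
proof -
  have "gradient (\<lambda>x. c + 1 / 2 * ((x - y) \<bullet> (H *v (x - y)))) = (\<lambda>x. H *v (x - y))"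
    using gradient_eqI[OF GDERIV_quadratic] assms by blast
  moreover have "frechet_derivative (\<lambda>x. H *v (x - y)) (at x) = (\<lambda>h. H *v h)"
    by (rule frechet_derivative_at[OF has_derivative_matrix_vector, symmetric])
  ultimately show ?thesis
    unfolding hessian_def by (simp add: matrix_of_matrix_vector_mul)
qed

lemma GDERIV_quad:
  fixes A :: "real ^ 'd ^ 'd"
  assumes sym: "\<And>x y. x \<bullet> (A *v y) = (A *v x) \<bullet> y"
  shows "GDERIV (quad A b) x :> A *v x - b"
proof -
  have "GDERIV (\<lambda>x. 0 + 1 / 2 * ((x - 0) \<bullet> (A *v (x - 0)))) x :> A *v (x - 0)"
    by (rule GDERIV_quadratic[OF sym])
  moreover have "GDERIV (\<lambda>x. b \<bullet> x) x :> b"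
    using has_derivative_inner_right[OF has_derivative_ident, of b]
    by (simp add: gderiv_def inner_commute)
  ultimately show ?thesis
    unfolding quad_def[abs_def] by (auto dest: GDERIV_diff)
qed

lemma matrix_vector_mult_sum:
  "(\<Sum>i\<in>I. M i) *v (x :: real ^ 'd) = (\<Sum>i\<in>I. M i *v x)"
  by (induction I rule: infinite_finite_induct) (auto simp: matrix_vector_mult_add_rdistrib)

lemma transpose_eq_selfI:
  fixes H :: "real ^ 'd ^ 'd"
  assumes "\<And>x y. x \<bullet> (H *v y) = (H *v x) \<bullet> y"
  shows "transpose H = H"
proof -
  have "(transpose H *v x) \<bullet> y = (H *v x) \<bullet> y" for x y
    using assms[of x y] by (simp add: transpose_matrix_vector dot_lmul_matrix)
  then show ?thesis
    by (metis matrix_eq vector_eq_rdot)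
qed

text \<open>Taylor expansion at a critical point, where the linear term vanishes.\<close>

lemma quad_eq:
  assumes "sym_psd A" and b: "A *v y = b"
  shows "quad A b x = quad A b y + 1 / 2 * ((x - y) \<bullet> (A *v (x - y)))"
  using sym_psd_inner_commute[OF assms(1), of y x]
  by (simp add: quad_def b[symmetric] matrix_vector_mult_diff_distrib inner_diff_left inner_diff_right
      inner_commute[of "A *v y"] algebra_simps)

section \<open>The averaged envelope\<close>

text \<open>The closed form of \<open>moreau_hessian\<close>, as \<open>moreau_hessian_eq\<close>
  shows. It does not involve \<open>b\<close>, so its spectral properties can be derived before
  interpolation enters.\<close>

definition avg_env_hessian :: "real \<Rightarrow> nat \<Rightarrow> (nat \<Rightarrow> real ^ 'd ^ 'd) \<Rightarrow> real ^ 'd ^ 'd" where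
  "avg_env_hessian \<gamma> n A = (1 / real n) *\<^sub>R (\<Sum>i = 1..n. env_hessian \<gamma> (A i))"

locale psd_family =
  fixes \<gamma> :: real and n :: nat and A :: "nat \<Rightarrow> real ^ 'd ^ 'd"
  assumes \<gamma>: "0 < \<gamma>" and n: "2 \<le> n" and psd: "\<And>i. i \<in> {1..n} \<Longrightarrow> sym_psd (A i)"
begin

abbreviation "H \<equiv> avg_env_hessian \<gamma> n A"

abbreviation "E i \<equiv> env_hessian \<gamma> (A i)"

lemma H_vector: "H *v w = (1 / real n) *\<^sub>R (\<Sum>i = 1..n. E i *v w)"
  by (simp add: avg_env_hessian_def matrix_vector_mult_sum flip: scaleR_matrix_vector_assoc)

lemma sum_inner_E: "(\<Sum>i = 1..n. w \<bullet> (E i *v w)) = n * (w \<bullet> (H *v w))"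
  using n by (simp add: H_vector inner_sum_right)

lemma H_inner_commute: "x \<bullet> (H *v y) = (H *v x) \<bullet> y"
  using env_hessian_inner_commute[OF psd \<gamma>]
  by (simp add: H_vector inner_sum_right inner_sum_left)

lemma sym_psd_H: "sym_psd H"
  unfolding sym_psd_def
proof safe
  show "transpose H = H"
    by (rule transpose_eq_selfI[OF H_inner_commute])
  show "0 \<le> v \<bullet> (H *v v)" for v
    using env_hessian_nonneg[OF psd \<gamma>]
    by (auto simp: H_vector inner_sum_right intro!: divide_nonneg_nonneg sum_nonneg)
qed

lemma lambda_max_le_L_max:
  assumes "i \<in> {1..n}"
  shows "lambda_max (A i) \<le> L_max n A"
  unfolding L_max_def using assms by (intro Max_ge) auto

lemma L_max_nonneg: "0 \<le> L_max n A"
  using sym_psd_lambda_max_nonneg[OF psd, of 1] lambda_max_le_L_max[of 1] n by simp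

lemma E_norm_le:
  assumes "i \<in> {1..n}"
  shows "(norm (E i *v w))\<^sup>2 \<le> L_max n A / (1 + \<gamma> * L_max n A) * (w \<bullet> (E i *v w))"
  by (rule env_hessian_norm_le[OF psd[OF assms] \<gamma> lambda_max_le_L_max[OF assms]])

text \<open>The forms of the \<open>E i\<close> are nonnegative and sum to zero at \<open>q\<close>,
  so each is zero there, and \<open>E_norm_le\<close> turns a vanishing form into a vanishing
  image.\<close>

lemma H_kernel_E:
  assumes "H *v q = 0" "i \<in> {1..n}"
  shows "E i *v q = 0"
proof -
  have "(\<Sum>i = 1..n. q \<bullet> (E i *v q)) = 0"
    using sum_inner_E[of q] assms(1) by simp
  then have "q \<bullet> (E i *v q) = 0"
    using env_hessian_nonneg[OF psd \<gamma>] assms(2) by (subst (asm) sum_nonneg_eq_0_iff) auto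
  then show ?thesis
    using E_norm_le[OF assms(2), of q] by simp
qed

lemma H_kernel_A:
  assumes "H *v q = 0" "i \<in> {1..n}"
  shows "A i *v q = 0"
  using env_hessian_kernel[OF psd[OF assms(2)] \<gamma> H_kernel_E[OF assms]] .

lemma L_max_pos:
  assumes "H \<noteq> 0"
  shows "0 < L_max n A"
proof (rule ccontr)
  assume "\<not> 0 < L_max n A"
  then have "L_max n A = 0" using L_max_nonneg by simp
  then have "E i *v w = 0" if "i \<in> {1..n}" for i w
    using E_norm_le[OF that, of w] by simp
  then have "H *v w = 0" for w by (simp add: H_vector)
  then show False using assms by (metis matrix_eq matrix_vector_mult_0)
qed

text \<open>The common solution \<open>y\<close> stays arbitrary because the final proof uses two of
  them: the given one and the one nearest to the starting point.\<close>

context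
  fixes b :: "nat \<Rightarrow> real ^ 'd" and y :: "real ^ 'd"
  assumes interpolation: "\<And>i. i \<in> {1..n} \<Longrightarrow> A i *v y = b i"
begin

lemma moreau_hessian_eq: "moreau_hessian \<gamma> n A b = H"
proof -
  have "avg_moreau \<gamma> n A b x = avg n (\<lambda>i. quad (A i) (b i)) y + 1 / 2 * ((x - y) \<bullet> (H *v (x - y)))" for x
  proof -
    have "(\<Sum>i = 1..n. moreau \<gamma> (quad (A i) (b i)) x) =
        (\<Sum>i = 1..n. quad (A i) (b i) y + 1 / 2 * ((x - y) \<bullet> (E i *v (x - y))))"
      by (intro sum.cong refl moreau_quad[OF psd \<gamma> interpolation])
    also have "\<dots> = (\<Sum>i = 1..n. quad (A i) (b i) y) + 1 / 2 * (n * ((x - y) \<bullet> (H *v (x - y))))"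
      unfolding sum_inner_E[symmetric] by (simp add: sum.distrib sum_distrib_left)
    finally show ?thesis
      using n by (simp add: avg_moreau_def avg_def field_simps)
  qed
  then have "avg_moreau \<gamma> n A b =
      (\<lambda>x. avg n (\<lambda>i. quad (A i) (b i)) y + 1 / 2 * ((x - y) \<bullet> (H *v (x - y))))" by blast
  then show ?thesis
    unfolding moreau_hessian_def using hessian_quadratic[of H, OF H_inner_commute] by simp
qed

text \<open>Converts squared distance to \<open>y\<close> into objective gap; \<open>y\<close> is
  critical for every summand, so no linear term appears.\<close>

lemma avg_quad_le: "avg n (\<lambda>i. quad (A i) (b i)) x
    \<le> avg n (\<lambda>i. quad (A i) (b i)) y + L_max n A / 2 * (norm (x - y))\<^sup>2"
proof -
  let ?r = "L_max n A / 2 * (norm (x - y))\<^sup>2"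
  have "quad (A i) (b i) x \<le> quad (A i) (b i) y + ?r" if i: "i \<in> {1..n}" for i
  proof -
    have "(x - y) \<bullet> (A i *v (x - y)) \<le> lambda_max (A i) * (norm (x - y))\<^sup>2"
      by (rule sym_psd_inner_le[OF psd[OF i]])
    also have "\<dots> \<le> L_max n A * (norm (x - y))\<^sup>2"
      by (intro mult_right_mono lambda_max_le_L_max i) simp
    finally show ?thesis
      unfolding quad_eq[OF psd[OF i] interpolation[OF i], of x] by simp
  qed
  then have "(\<Sum>i = 1..n. quad (A i) (b i) x) \<le> (\<Sum>i = 1..n. quad (A i) (b i) y + ?r)"
    by (rule sum_mono)
  also have "\<dots> = (\<Sum>i = 1..n. quad (A i) (b i) y) + n * ?r"
    by (simp add: sum.distrib)
  finally have "(\<Sum>i = 1..n. quad (A i) (b i) x) / n \<le> ((\<Sum>i = 1..n. quad (A i) (b i) y) + n * ?r) / n"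
    by (rule divide_right_mono) simp
  then show ?thesis
    using n by (simp add: avg_def add_divide_distrib)
qed

section \<open>One step of the method\<close>

context
  fixes S :: nat
  assumes S: "1 \<le> S" "S \<le> n" and H: "H \<noteq> 0"
begin

abbreviation "L \<equiv> L_gamma_S \<gamma> n S A b"

abbreviation "\<mu> \<equiv> mu_gamma_plus \<gamma> n A b"

abbreviation "subsets \<equiv> {T. T \<subseteq> {1..n} \<and> card T = S}"

abbreviation "step \<equiv> fedexprox_step (1 / (\<gamma> * L)) \<gamma> S (\<lambda>i. quad (A i) (b i))"

abbreviation "iterates \<equiv> fedexprox (1 / (\<gamma> * L)) \<gamma> n S (\<lambda>i. quad (A i) (b i))"

lemma subsets: "finite subsets" "card subsets = n choose S" "subsets \<noteq> {}" "0 < n choose S"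
proof -
  show *: "finite subsets" "card subsets = n choose S" "0 < n choose S"
    using S by (auto simp: n_subsets)
  then show "subsets \<noteq> {}" by (metis card.empty less_irrefl)
qed

lemma set_pmf_subsets: "set_pmf (pmf_of_set subsets) = subsets"
  by (rule set_pmf_of_set[OF subsets(3,1)])

text \<open>Both coefficients are nonnegative and never vanish together: the first is positive for
  \<open>S = 1\<close>, the second for larger \<open>S\<close>.\<close>

lemma L_pos: "0 < L"
proof -
  have "0 < L_max n A / (1 + \<gamma> * L_max n A)"
    using L_max_pos[OF H] \<gamma> by (intro divide_pos_pos add_pos_pos mult_pos_pos) auto
  moreover have "0 < L_gamma \<gamma> n A b"
    unfolding L_gamma_def moreau_hessian_eq using sym_psd_lambda_max_pos[OF sym_psd_H H] .
  moreover have "0 \<le> (real n - real S) / (real S * (real n - 1))"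
    using S n by (intro divide_nonneg_nonneg mult_nonneg_nonneg) auto
  moreover have "0 \<le> real n * (real S - 1) / (real S * (real n - 1))"
    using S n by (intro divide_nonneg_nonneg mult_nonneg_nonneg) auto
  moreover have "0 < (real n - real S) / (real S * (real n - 1)) \<or>
      0 < real n * (real S - 1) / (real S * (real n - 1))"
  proof (cases "S = 1")
    case True
    then show ?thesis using n by simp
  next
    case False
    then show ?thesis
      using S n by (intro disjI2 divide_pos_pos mult_pos_pos) auto
  qed
  ultimately show ?thesis
    unfolding L_gamma_S_def
    by (metis add_nonneg_pos add_pos_nonneg less_imp_le mult_nonneg_nonneg mult_pos_pos)
qed

lemma step_eq:
  assumes "T \<in> subsets"
  shows "step T x - y = (x - y) - (1 / (L * S)) *\<^sub>R (\<Sum>i\<in>T. E i *v (x - y))"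
proof -
  let ?s = "\<Sum>i\<in>T. E i *v (x - y)"
  have "(\<Sum>i\<in>T. prox \<gamma> (quad (A i) (b i)) x) = (\<Sum>i\<in>T. x - \<gamma> *\<^sub>R (E i *v (x - y)))"
  proof (rule sum.cong[OF refl])
    fix i assume "i \<in> T"
    then have i: "i \<in> {1..n}" using assms by auto
    show "prox \<gamma> (quad (A i) (b i)) x = x - \<gamma> *\<^sub>R (E i *v (x - y))"
      unfolding prox_quad[OF psd[OF i] \<gamma> interpolation[OF i]] resolvent_vector[OF psd[OF i] \<gamma>] by simp
  qed
  also have "\<dots> = real S *\<^sub>R x - \<gamma> *\<^sub>R ?s"
    using assms by (simp add: sum_subtractf sum_constant_scaleR scaleR_sum_right del: sum_constant)
  finally have "(1 / real S) *\<^sub>R (\<Sum>i\<in>T. prox \<gamma> (quad (A i) (b i)) x) - x = - (\<gamma> / S) *\<^sub>R ?s"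
    using S by (simp add: scaleR_diff_right)
  then show ?thesis
    unfolding fedexprox_step_def using \<gamma> by simp
qed

lemma second_moment_le:
  "(\<Sum>T\<in>subsets. (norm (\<Sum>i\<in>T. E i *v w))\<^sup>2) \<le> (n choose S) * (real S)\<^sup>2 * (L * (w \<bullet> (H *v w)))"
proof -
  let ?\<kappa> = "L_max n A / (1 + \<gamma> * L_max n A)"
  let ?c1 = "(real n - real S) / (real S * (real n - 1))"
  let ?c2 = "real n * (real S - 1) / (real S * (real n - 1))"
  let ?e = "w \<bullet> (H *v w)"
  define Q where "Q = (\<Sum>i = 1..n. (norm (E i *v w))\<^sup>2) / n"
  have nS: "real n > 0" "real n - 1 > 0" "real S > 0" using n S by auto
  have norm_sum: "(norm (\<Sum>i = 1..n. E i *v w))\<^sup>2 = (real n)\<^sup>2 * (norm (H *v w))\<^sup>2"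
    using n by (simp add: H_vector power_mult_distrib[symmetric])
  have sum_Q: "(\<Sum>i = 1..n. (norm (E i *v w))\<^sup>2) = n * Q"
    using n by (simp add: Q_def)
  have "(\<Sum>T\<in>subsets. (norm (\<Sum>i\<in>T. E i *v w))\<^sup>2) =
      (n choose S) * (S / n * (n * Q)
        + S * (real S - 1) / (n * (real n - 1)) * ((real n)\<^sup>2 * (norm (H *v w))\<^sup>2 - n * Q))"
    using sum_norm_subset_sums[of "{1..n}" n S "\<lambda>i. E i *v w"] n S by (simp add: norm_sum sum_Q del: One_nat_def)
  \<comment> \<open>Collecting the multiples of \<open>Q\<close> and of the squared norm of
    \<open>H *v w\<close> produces exactly the two coefficients of \<open>L_gamma_S\<close>.\<close>
  also have "S / n * (n * Q) + S * (real S - 1) / (n * (real n - 1)) * ((real n)\<^sup>2 * (norm (H *v w))\<^sup>2 - n * Q)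
      = (real S)\<^sup>2 * (?c1 * Q + ?c2 * (norm (H *v w))\<^sup>2)"
    using nS by (simp add: divide_simps power2_eq_square) (simp add: algebra_simps)
  finally have eq: "(\<Sum>T\<in>subsets. (norm (\<Sum>i\<in>T. E i *v w))\<^sup>2) =
      (n choose S) * ((real S)\<^sup>2 * (?c1 * Q + ?c2 * (norm (H *v w))\<^sup>2))" .
  have "Q \<le> ?\<kappa> * ?e"
  proof -
    have "n * Q \<le> (\<Sum>i = 1..n. ?\<kappa> * (w \<bullet> (E i *v w)))"
      unfolding sum_Q[symmetric] by (intro sum_mono E_norm_le)
    also have "\<dots> = n * (?\<kappa> * ?e)"
      unfolding sum_distrib_left[symmetric] sum_inner_E by simp
    finally show ?thesis
      by (rule mult_left_le_imp_le) (rule nS)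
  qed
  moreover have "(norm (H *v w))\<^sup>2 \<le> L_gamma \<gamma> n A b * ?e"
    unfolding L_gamma_def moreau_hessian_eq by (rule sym_psd_norm_le[OF sym_psd_H])
  ultimately have "?c1 * Q + ?c2 * (norm (H *v w))\<^sup>2 \<le> ?c1 * (?\<kappa> * ?e) + ?c2 * (L_gamma \<gamma> n A b * ?e)"
    using S n by (intro add_mono mult_left_mono divide_nonneg_nonneg mult_nonneg_nonneg) auto
  also have "\<dots> = L * ?e"
    unfolding L_gamma_S_def by (simp add: algebra_simps)
  finally have "(n choose S) * ((real S)\<^sup>2 * (?c1 * Q + ?c2 * (norm (H *v w))\<^sup>2))
      \<le> (n choose S) * ((real S)\<^sup>2 * (L * ?e))"
    by (intro mult_left_mono) auto
  then show ?thesis unfolding eq by (simp add: mult.assoc)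
qed

text \<open>In the expanded square the mean contributes \<open>- 2 / L\<close> and the second moment
  at most \<open>1 / L\<close> times the form of \<open>H\<close>. The step size
  \<open>1 / L\<close> minimizes this upper bound.\<close>

lemma step_descent:
  "(\<Sum>T\<in>subsets. (norm (step T x - y))\<^sup>2) / card subsets
     \<le> (norm (x - y))\<^sup>2 - 1 / L * ((x - y) \<bullet> (H *v (x - y)))"
proof -
  define w where "w = x - y"
  define s where "s T = (\<Sum>i\<in>T. E i *v w)" for T
  define c where "c = 1 / (L * S)"
  let ?N = "real (n choose S)" and ?e = "w \<bullet> (H *v w)"
  have N: "?N > 0" using subsets(4) by simp
  have expand: "(norm (w - c *\<^sub>R u))\<^sup>2 = (norm w)\<^sup>2 - 2 * c * (w \<bullet> u) + c\<^sup>2 * (norm u)\<^sup>2" for u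
    unfolding power2_norm_eq_inner
    by (simp add: inner_diff_left inner_diff_right inner_commute power2_eq_square algebra_simps)
  have "(\<Sum>T\<in>subsets. (norm (step T x - y))\<^sup>2) = (\<Sum>T\<in>subsets. (norm (w - c *\<^sub>R s T))\<^sup>2)"
    by (intro sum.cong) (auto simp: step_eq w_def s_def c_def)
  also have "\<dots> = (\<Sum>T\<in>subsets. (norm w)\<^sup>2 - 2 * c * (w \<bullet> s T) + c\<^sup>2 * (norm (s T))\<^sup>2)"
    by (intro sum.cong refl expand)
  also have "\<dots> = ?N * (norm w)\<^sup>2 - 2 * c * (w \<bullet> (\<Sum>T\<in>subsets. s T)) + c\<^sup>2 * (\<Sum>T\<in>subsets. (norm (s T))\<^sup>2)"
    by (simp add: sum.distrib sum_subtractf sum_distrib_left inner_sum_right subsets del: One_nat_def)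
  also have "(\<Sum>T\<in>subsets. s T) = (?N * S) *\<^sub>R (H *v w)"
    unfolding s_def H_vector using sum_subset_sums[of "{1..n}" n S "\<lambda>i. E i *v w"] n S by simp
  also have "?N * (norm w)\<^sup>2 - 2 * c * (w \<bullet> ((?N * S) *\<^sub>R (H *v w))) + c\<^sup>2 * (\<Sum>T\<in>subsets. (norm (s T))\<^sup>2)
      \<le> ?N * (norm w)\<^sup>2 - 2 * c * (w \<bullet> ((?N * S) *\<^sub>R (H *v w))) + c\<^sup>2 * (?N * (real S)\<^sup>2 * (L * ?e))"
    unfolding s_def by (intro add_left_mono mult_left_mono second_moment_le) simp
  also have "\<dots> = ?N * ((norm w)\<^sup>2 - 1 / L * ?e)"
    unfolding c_def using L_pos S by (simp add: field_simps power2_eq_square)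
  finally show ?thesis
    using N by (simp add: subsets w_def pos_divide_le_eq mult.commute del: One_nat_def)
qed

lemma expected_step_le:
  assumes "\<And>q. H *v q = 0 \<Longrightarrow> q \<bullet> (x - y) = 0"
  shows "measure_pmf.expectation (map_pmf (\<lambda>T. step T x) (pmf_of_set subsets)) (\<lambda>x. (norm (x - y))\<^sup>2)
    \<le> (1 - \<mu> / L) * (norm (x - y))\<^sup>2"
proof -
  have "measure_pmf.expectation (map_pmf (\<lambda>T. step T x) (pmf_of_set subsets)) (\<lambda>x. (norm (x - y))\<^sup>2)
      = (\<Sum>T\<in>subsets. (norm (step T x - y))\<^sup>2) / card subsets"
    using integral_pmf_of_set[OF subsets(3,1)] by simp
  also have "\<dots> \<le> (norm (x - y))\<^sup>2 - 1 / L * ((x - y) \<bullet> (H *v (x - y)))"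
    by (rule step_descent)
  also have "\<dots> \<le> (norm (x - y))\<^sup>2 - 1 / L * (\<mu> * (norm (x - y))\<^sup>2)"
    unfolding mu_gamma_plus_def moreau_hessian_eq using L_pos
    by (intro diff_left_mono mult_left_mono sym_psd_lambda_min_nz(2)[OF sym_psd_H H] assms) auto
  finally show ?thesis by (simp add: algebra_simps)
qed

section \<open>Convergence of the iterates\<close>

text \<open>Finite support turns expectations into finite sums and makes every function
  integrable.\<close>

lemma finite_set_pmf_iterates: "finite (set_pmf (iterates x\<^sub>0 k))"
  by (induction k) (auto simp: set_pmf_subsets subsets(1) simp del: One_nat_def)

text \<open>Each step moves along images of the symmetric \<open>E i\<close>, which are orthogonal
  to the kernel of \<open>H\<close> because every \<open>E i\<close> annihilates that
  kernel.\<close>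

lemma iterates_orthogonal_kernel:
  assumes "\<And>q. H *v q = 0 \<Longrightarrow> q \<bullet> (x\<^sub>0 - y) = 0" and "x \<in> set_pmf (iterates x\<^sub>0 k)" and q: "H *v q = 0"
  shows "q \<bullet> (x - y) = 0"
  using assms(2)
proof (induction k arbitrary: x)
  case 0
  then show ?case using assms by simp
next
  case (Suc k)
  then obtain z T where z: "z \<in> set_pmf (iterates x\<^sub>0 k)" and T: "T \<in> subsets" and x: "x = step T z"
    by (auto simp: set_pmf_subsets simp del: One_nat_def)
  have "q \<bullet> (E i *v v) = 0" if "i \<in> T" for i v
  proof -
    have i: "i \<in> {1..n}" using T that by auto
    show ?thesis
      using env_hessian_inner_commute[OF psd[OF i] \<gamma>, of q v] H_kernel_E[OF q i] by simp
  qed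
  then show ?case
    unfolding x step_eq[OF T] using Suc.IH[OF z] by (simp add: inner_diff_right inner_sum_right)
qed

lemma expectation_iterates_le:
  assumes orth: "\<And>q. H *v q = 0 \<Longrightarrow> q \<bullet> (x\<^sub>0 - y) = 0"
  shows "measure_pmf.expectation (iterates x\<^sub>0 k) (\<lambda>x. (norm (x - y))\<^sup>2)
    \<le> exp (- (real k * (\<mu> / L))) * (norm (x\<^sub>0 - y))\<^sup>2"
proof (induction k)
  case 0
  then show ?case by simp
next
  case (Suc k)
  let ?V = "\<lambda>x. (norm (x - y))\<^sup>2" and ?p = "iterates x\<^sub>0 k"
  let ?next = "\<lambda>x. map_pmf (\<lambda>T. step T x) (pmf_of_set subsets)"
  have "measure_pmf.expectation (iterates x\<^sub>0 (Suc k)) ?V =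
      (\<Sum>x\<in>set_pmf ?p. pmf ?p x *\<^sub>R measure_pmf.expectation (?next x) ?V)"
    unfolding fedexprox.simps
    by (rule pmf_expectation_bind[OF finite_set_pmf_iterates])
       (auto simp: set_pmf_subsets subsets(1) simp del: One_nat_def)
  also have "\<dots> \<le> (\<Sum>x\<in>set_pmf ?p. pmf ?p x *\<^sub>R (exp (- (\<mu> / L)) * ?V x))"
  proof (intro sum_mono scaleR_left_mono)
    fix x assume "x \<in> set_pmf ?p"
    then have "measure_pmf.expectation (?next x) ?V \<le> (1 - \<mu> / L) * ?V x"
      using iterates_orthogonal_kernel[OF orth] by (intro expected_step_le) blast
    \<comment> \<open>Passing to \<open>exp\<close> here makes the factor positive, so the induction
      hypothesis can be multiplied by it without showing \<open>\<mu> \<le> L\<close>.\<close>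
    also have "\<dots> \<le> exp (- (\<mu> / L)) * ?V x"
      using exp_ge_add_one_self[of "- (\<mu> / L)"] by (intro mult_right_mono) auto
    finally show "measure_pmf.expectation (?next x) ?V \<le> exp (- (\<mu> / L)) * ?V x" .
  qed simp
  also have "\<dots> = exp (- (\<mu> / L)) * measure_pmf.expectation ?p ?V"
    by (subst integral_measure_pmf[OF finite_set_pmf_iterates]) (auto simp: sum_distrib_left mult_ac)
  also have "\<dots> \<le> exp (- (\<mu> / L)) * (exp (- (real k * (\<mu> / L))) * (norm (x\<^sub>0 - y))\<^sup>2)"
    by (intro mult_left_mono Suc.IH) simp
  also have "\<dots> = exp (- (real (Suc k) * (\<mu> / L))) * (norm (x\<^sub>0 - y))\<^sup>2"
    by (simp add: exp_add[symmetric] algebra_simps add_divide_distrib)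
  finally show ?case .
qed

lemma expectation_objective_le:
  assumes "\<And>q. H *v q = 0 \<Longrightarrow> q \<bullet> (x\<^sub>0 - y) = 0"
  shows "measure_pmf.expectation (iterates x\<^sub>0 k) (avg n (\<lambda>i. quad (A i) (b i)))
      - avg n (\<lambda>i. quad (A i) (b i)) y
    \<le> L_max n A / 2 * (norm (x\<^sub>0 - y))\<^sup>2 * exp (- (real k * (\<mu> / L)))"
proof -
  let ?f = "avg n (\<lambda>i. quad (A i) (b i))" and ?V = "\<lambda>x. (norm (x - y))\<^sup>2" and ?p = "iterates x\<^sub>0 k"
  have int: "integrable (measure_pmf ?p) g" for g :: "real ^ 'd \<Rightarrow> real"
    by (rule integrable_measure_pmf_finite[OF finite_set_pmf_iterates])
  have "measure_pmf.expectation ?p ?f \<le> measure_pmf.expectation ?p (\<lambda>x. ?f y + L_max n A / 2 * ?V x)"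
    by (intro integral_mono int avg_quad_le)
  also have "\<dots> = ?f y + L_max n A / 2 * measure_pmf.expectation ?p ?V"
    by (subst Bochner_Integration.integral_add[OF int int]) simp
  also have "\<dots> \<le> ?f y + L_max n A / 2 * (exp (- (real k * (\<mu> / L))) * ?V x\<^sub>0)"
    using L_max_nonneg by (intro add_left_mono mult_left_mono expectation_iterates_le[OF assms]) auto
  finally show ?thesis by (simp add: mult_ac)
qed

end

end

end

section \<open>From the exponential rate to an iteration count\<close>

text \<open>Since \<open>C > 1\<close>, the quantity \<open>K * \<epsilon> powr (C - 1)\<close>
  tends to \<open>K * 0 powr (C - 1)\<close>, which is zero. This absorbs the factor
  \<open>K\<close> that carries the initial distance.\<close>

lemma eventually_mult_powr_le:
  fixes K C :: real
  assumes "0 \<le> K" "1 < C"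
  shows "\<forall>\<^sub>F \<epsilon> in at_right 0. 0 < \<epsilon> \<and> K * \<epsilon> powr C \<le> \<epsilon>"
proof -
  have "((\<lambda>\<epsilon>. \<epsilon>) \<longlongrightarrow> (0::real)) (at_right 0)"
    by (rule tendsto_ident_at)
  then have "((\<lambda>\<epsilon>. K * \<epsilon> powr (C - 1)) \<longlongrightarrow> K * 0 powr (C - 1)) (at_right (0::real))"
    using assms by (intro tendsto_intros tendsto_powr2) (auto simp: eventually_at_right_less intro: eventually_mono[OF eventually_at_right_less])
  then have "\<forall>\<^sub>F \<epsilon> in at_right (0::real). K * \<epsilon> powr (C - 1) < 1"
    by (rule order_tendstoD) simp
  with eventually_at_right_less[of "0::real"] show ?thesis
  proof eventually_elim
    case (elim \<epsilon>)
    have "K * \<epsilon> powr C = K * \<epsilon> powr (C - 1) * \<epsilon>"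
      using elim by (simp add: powr_diff)
    also have "\<dots> \<le> 1 * \<epsilon>"
      using elim by (intro mult_right_mono) auto
    finally show ?case using elim by simp
  qed
qed

text \<open>The O-notation is read as \<epsilon> tending to zero from above with the problem data
  and \<open>x\<^sub>0\<close> fixed; how small \<epsilon> must be may depend on them and on
  \<open>C\<close>. The output is the last iterate.\<close>

theorem theorem5p1:
  fixes A :: "nat \<Rightarrow> real ^ 'd ^ 'd" and b :: "nat \<Rightarrow> real ^ 'd"
    and x\<^sub>0 x_star :: "real ^ 'd" and \<gamma> C :: real and n S :: nat
  defines "F \<equiv> \<lambda>i. quad (A i) (b i)"
  defines "f \<equiv> avg n F"
  defines "L \<equiv> L_gamma_S \<gamma> n S A b"
  defines "\<mu> \<equiv> mu_gamma_plus \<gamma> n A b"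
  defines "\<alpha> \<equiv> 1 / (\<gamma> * L)"
  assumes "\<gamma> > 0"
    and "n \<ge> 2"
    and "1 \<le> S" and "S \<le> n"
    and "\<And>i. i \<in> {1..n} \<Longrightarrow> sym_psd (A i)"
    and "\<And>i. i \<in> {1..n} \<Longrightarrow> GDERIV (F i) x_star :> 0"
    and "C > 1"
  shows "\<forall>\<^sub>F \<epsilon> in at_right 0. \<forall>k. real k \<ge> C * (L / \<mu> * ln (1 / \<epsilon>)) \<longrightarrow>
           measure_pmf.expectation (fedexprox \<alpha> \<gamma> n S F x\<^sub>0 k) f - f x_star \<le> \<epsilon>"
proof -
  interpret psd_family \<gamma> n A
    using assms by unfold_locales auto
  have star: "A i *v x_star = b i" if i: "i \<in> {1..n}" for i
  proof -
    have "GDERIV (F i) x_star :> A i *v x_star - b i"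
      unfolding F_def by (rule GDERIV_quad[OF sym_psd_inner_commute[OF psd[OF i]]])
    then have "A i *v x_star - b i = 0"
      using gradient_eqI assms(11)[OF i] by metis
    then show ?thesis by simp
  qed
  show ?thesis
  proof (cases "H = 0")
    \<comment> \<open>Here \<open>\<mu>\<close> is the \<open>Min\<close> of an empty set and
      nothing is known about \<open>L / \<mu>\<close>. But all \<open>A i\<close> vanish, hence all
      \<open>b i\<close>, so \<open>f\<close> is identically zero.\<close>
    case True
    have "quad (A i) (b i) x = 0" if i: "i \<in> {1..n}" for i x
    proof -
      have "A i *v v = 0" for v
        using H_kernel_A[OF _ i] True by simp
      then show ?thesis
        using star[OF i] by (simp add: quad_def)
    qed
    then have "f = (\<lambda>_. 0)"
      by (simp add: f_def F_def avg_def fun_eq_iff)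
    then show ?thesis
      using eventually_at_right_less[of "0::real"] by (auto elim!: eventually_mono)
  next
    case False
    have "subspace {q. H *v q = 0}"
      by (simp add: subspace_def matrix_vector_right_distrib matrix_vector_mult_scaleR)
    then have span: "span {q. H *v q = 0} = {q. H *v q = 0}"
      by (simp add: span_eq_iff)
    \<comment> \<open>The component \<open>q\<close> of \<open>x\<^sub>0 - x_star\<close> in the
      kernel of \<open>H\<close> shifts \<open>x_star\<close> to \<open>y\<close>, the projection of
      \<open>x\<^sub>0\<close> onto the common minimizers; \<open>r\<close> is what remains of the
      initial error.\<close>
    obtain q r where q: "H *v q = 0" and r: "\<And>v. H *v v = 0 \<Longrightarrow> orthogonal r v"
      and qr: "x\<^sub>0 - x_star = q + r"
      using orthogonal_subspace_decomp_exists[of "{q. H *v q = 0}" "x\<^sub>0 - x_star"] unfolding span by auto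
    define y where "y = x_star + q"
    have y: "A i *v y = b i" if "i \<in> {1..n}" for i
      using star[OF that] H_kernel_A[OF q that] by (simp add: y_def matrix_vector_right_distrib)
    have orth: "v \<bullet> (x\<^sub>0 - y) = 0" if "H *v v = 0" for v
    proof -
      have "x\<^sub>0 - y = r" using qr by (simp add: y_def algebra_simps)
      then show ?thesis using r[OF that] by (simp add: orthogonal_def inner_commute)
    qed
    have "f y = f x_star"
    proof -
      have "quad (A i) (b i) y = quad (A i) (b i) x_star" if "i \<in> {1..n}" for i
        unfolding quad_eq[OF psd[OF that] star[OF that], of y]
        using H_kernel_A[OF q that] by (simp add: y_def)
      then show ?thesis by (simp add: f_def F_def avg_def)
    qed
    have L: "0 < L"
      unfolding L_def by (rule L_pos[OF y assms(8,9) False])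
    have \<mu>: "0 < \<mu>"
    proof -
      have "moreau_hessian \<gamma> n A b = H"
        by (rule moreau_hessian_eq[OF star])
      then show ?thesis
        unfolding \<mu>_def mu_gamma_plus_def using sym_psd_lambda_min_nz(1)[OF sym_psd_H False] by simp
    qed
    define K where "K = L_max n A / 2 * (norm (x\<^sub>0 - y))\<^sup>2"
    have "0 \<le> K" using L_max_nonneg by (simp add: K_def)
    have bound: "measure_pmf.expectation (fedexprox \<alpha> \<gamma> n S F x\<^sub>0 k) f - f x_star
        \<le> K * exp (- (real k * (\<mu> / L)))" for k
      using expectation_objective_le[OF y assms(8,9) False orth, of k]
      unfolding \<open>f y = f x_star\<close>[symmetric]
      unfolding K_def f_def F_def \<alpha>_def L_def \<mu>_def by simp
    show ?thesis
      using eventually_mult_powr_le[OF \<open>0 \<le> K\<close> \<open>C > 1\<close>]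
    proof (rule eventually_mono, intro allI impI)
      fix \<epsilon> k assume \<epsilon>: "0 < \<epsilon> \<and> K * \<epsilon> powr C \<le> \<epsilon>" and k: "C * (L / \<mu> * ln (1 / \<epsilon>)) \<le> real k"
      \<comment> \<open>The threshold on \<open>k\<close> makes the exponential at most
        \<open>\<epsilon> powr C\<close>.\<close>
      have "C * ln (1 / \<epsilon>) \<le> real k * (\<mu> / L)"
        using k L \<mu> by (simp add: field_simps)
      then have "exp (- (real k * (\<mu> / L))) \<le> exp (C * ln \<epsilon>)"
        using \<epsilon> by (simp add: ln_div)
      also have "\<dots> = \<epsilon> powr C"
        using \<epsilon> by (simp add: powr_def)
      finally have "K * exp (- (real k * (\<mu> / L))) \<le> K * \<epsilon> powr C"
        using \<open>0 \<le> K\<close> by (rule mult_left_mono)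
      then show "measure_pmf.expectation (fedexprox \<alpha> \<gamma> n S F x\<^sub>0 k) f - f x_star \<le> \<epsilon>"
        using bound[of k] \<epsilon> by linarith
    qed
  qed
qed

end
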